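(* For every $n$ and every $\ell>0$, the bicycle correspondence $\mathcal{B}_{2\ell}$ on closed curves in $\mathbb{R}^n$ preserves the differential 2-form $\omega$. For $n=3$ and every $\ell>0$, the bicycle correspondence $\mathcal{B}_{2\ell}$ on closed curves in $\mathbb{R}^3$ preserves the differential 2-form $\Omega$.
   Context: Curves are smooth closed parameterized curves $\Gamma(t)$ in $\mathbb{R}^n$; a tangent vector to the space of curves at $\Gamma$ is a (periodic) vector field $u(t)$ along $\Gamma$. The forms are $$\omega(u,v)=\int u'(t)\cdot v(t)\,dt \quad(\text{in }\mathbb{R}^n),\qquad \Omega(u,v)=\int\det(\Gamma'(t),u(t),v(t))\,dt\quad(\text{in }\mathbb{R}^3),$$ where $u,v$ are vector fields along $\Gamma$; the integrals are over the closed curve. Bicycle correspondence: two closed curves $\Gamma_1,\Gamma_2$ in $\mathbb{R}^n$ are in the bicycle correspondence, written $\mathcal{B}_{2\ell}(\Gamma_1,\Gamma_2)$, if they can be traversed simultaneously by points $x_1=\Gamma_1(t)$, $x_2=\Gamma_2(t)$ such that $|x_1-x_2|=2\ell$ for all $t$ and the velocity of the midpoint $\frac12(x_1+x_2)$ is aligned with (parallel to, possibly zero) the segment $x_1x_2$. The midpoint curve $\gamma$ (the common rear track) may have cusps (generically, semi-cubical ones); equivalently, $\Gamma_1$ and $\Gamma_2$ are the loci of the endpoints of the tangent segments of length $\ell$ to $\gamma$ for its two coorientations. Meaning of "preserves": if $U_1,V_1$ along $\Gamma_1$ and $U_2,V_2$ along $\Gamma_2$ are such that the pairs $(U_1,U_2)$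 and $(V_1,V_2)$ are infinitesimal deformations of the pair $(\Gamma_1,\Gamma_2)$ within the set of pairs of curves in the relation $\mathcal{B}_{2\ell}$ (with corresponding parameterizations), then $\omega(U_1,V_1)=\omega(U_2,V_2)$ (respectively $\Omega(U_1,V_1)=\Omega(U_2,V_2)$). In other words, the pullbacks of the form under the two maps (rear track $\mapsto\Gamma_1$ and rear track $\mapsto\Gamma_2$) coincide. *)

theory Defs
  imports "HOL-Analysis.Analysis"
begin

(* C^k on an open set S: f is continuous for k = 0; for k + 1, f is differentiable and all its
   directional derivatives are C^k.  Only meant for open S, as derivatives are taken at full
   neighbourhoods. *)
primrec times_differentiable_on ::
  "nat \<Rightarrow> 'a::euclidean_space set \<Rightarrow> ('a \<Rightarrow> 'b::real_normed_vector) \<Rightarrow> bool" where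
  "times_differentiable_on 0 S f \<longleftrightarrow> continuous_on S f"
| "times_differentiable_on (Suc k) S f \<longleftrightarrow>
     (\<forall>x\<in>S. f differentiable (at x)) \<and>
     (\<forall>v. times_differentiable_on k S (\<lambda>x. frechet_derivative f (at x) v))"

definition smooth_on :: "'a::euclidean_space set \<Rightarrow> ('a \<Rightarrow> 'b::real_normed_vector) \<Rightarrow> bool" where
  "smooth_on S f \<longleftrightarrow> (\<forall>k. times_differentiable_on k S f)"

(* A closed curve is a smooth T-periodic map; it need not be an immersion. *)
definition closed_curve :: "real \<Rightarrow> (real \<Rightarrow> 'a::euclidean_space) \<Rightarrow> bool" where
  "closed_curve T \<Gamma> \<longleftrightarrow> smooth_on UNIV \<Gamma> \<and> (\<forall>t. \<Gamma> (t + T) = \<Gamma> t)"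

(* The two curves carry the parameterizations by which they are traversed simultaneously;
   d is the constant distance between corresponding points (d = 2 l for the relation B_{2l}). *)
definition bicycle_correspondence ::
  "real \<Rightarrow> real \<Rightarrow> (real \<Rightarrow> 'a::euclidean_space) \<Rightarrow> (real \<Rightarrow> 'a) \<Rightarrow> bool" where
  "bicycle_correspondence T d \<Gamma>1 \<Gamma>2 \<longleftrightarrow>
     closed_curve T \<Gamma>1 \<and> closed_curve T \<Gamma>2 \<and>
     (\<forall>t. dist (\<Gamma>1 t) (\<Gamma>2 t) = d) \<and>
     (\<forall>t. \<exists>c. vector_derivative (\<lambda>t. midpoint (\<Gamma>1 t) (\<Gamma>2 t)) (at t) = c *\<^sub>R (\<Gamma>1 t - \<Gamma>2 t))"

(* (U1, U2) is the velocity at s = 0 of a smooth one-parameter family (G1 s, G2 s) of pairs of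
   curves in bicycle correspondence that passes through (\<Gamma>1, \<Gamma>2) at s = 0. *)
definition infinitesimal_deformation ::
  "real \<Rightarrow> real \<Rightarrow> (real \<Rightarrow> 'a::euclidean_space) \<Rightarrow> (real \<Rightarrow> 'a) \<Rightarrow>
    (real \<Rightarrow> 'a) \<Rightarrow> (real \<Rightarrow> 'a) \<Rightarrow> bool" where
  "infinitesimal_deformation T d \<Gamma>1 \<Gamma>2 U1 U2 \<longleftrightarrow>
     (\<exists>\<epsilon>>0. \<exists>G1 G2.
        smooth_on ({-\<epsilon><..<\<epsilon>} \<times> UNIV) (\<lambda>(s, t). G1 s t) \<and>
        smooth_on ({-\<epsilon><..<\<epsilon>} \<times> UNIV) (\<lambda>(s, t). G2 s t) \<and>
        (\<forall>s\<in>{-\<epsilon><..<\<epsilon>}. bicycle_correspondence T d (G1 s) (G2 s)) \<and>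
        G1 0 = \<Gamma>1 \<and> G2 0 = \<Gamma>2 \<and>
        (\<forall>t. ((\<lambda>s. G1 s t) has_vector_derivative U1 t) (at 0)) \<and>
        (\<forall>t. ((\<lambda>s. G2 s t) has_vector_derivative U2 t) (at 0)))"

(* F \<Gamma> u v is the value of the 2-form at the curve \<Gamma> on the vector fields u, v along \<Gamma>. *)
definition bicycle_preserves ::
  "real \<Rightarrow> real \<Rightarrow>
    ((real \<Rightarrow> 'a::euclidean_space) \<Rightarrow> (real \<Rightarrow> 'a) \<Rightarrow> (real \<Rightarrow> 'a) \<Rightarrow> real) \<Rightarrow> bool" where
  "bicycle_preserves T d F \<longleftrightarrow>
     (\<forall>\<Gamma>1 \<Gamma>2 U1 U2 V1 V2.
        bicycle_correspondence T d \<Gamma>1 \<Gamma>2 \<longrightarrow>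
        infinitesimal_deformation T d \<Gamma>1 \<Gamma>2 U1 U2 \<longrightarrow>
        infinitesimal_deformation T d \<Gamma>1 \<Gamma>2 V1 V2 \<longrightarrow>
        F \<Gamma>1 U1 V1 = F \<Gamma>2 U2 V2)"

(* The base curve enters only through the vector fields being along it. *)
definition omega_form ::
  "real \<Rightarrow> (real \<Rightarrow> 'a::euclidean_space) \<Rightarrow> (real \<Rightarrow> 'a) \<Rightarrow> (real \<Rightarrow> 'a) \<Rightarrow> real" where
  "omega_form T \<Gamma> u v = integral {0..T} (\<lambda>t. vector_derivative u (at t) \<bullet> v t)"

definition Omega_form ::
  "real \<Rightarrow> (real \<Rightarrow> real^3) \<Rightarrow> (real \<Rightarrow> real^3) \<Rightarrow> (real \<Rightarrow> real^3) \<Rightarrow> real" where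
  "Omega_form T \<Gamma> u v =
     integral {0..T} (\<lambda>t. det (vector [vector_derivative \<Gamma> (at t), u t, v t] :: real^3^3))"

end

(* Put p = U1 + U2, q = U1 - U2, P = V1 + V2, Q = V1 - V2, m = Gamma1 + Gamma2, r = Gamma1 - Gamma2.  The relation
   says that |r| is constant and m' = mu r, and linearising it gives r . q = 0 and p' = k r + mu q
   (likewise for P, Q).  In these variables the two integrands differ by an exact derivative, namely by
   (q . P)' / 2 for omega, and by det (r, p, P)' / 4 for Omega.  In the latter case the term
   det (r', q, Q) vanishes because r', q, Q are all orthogonal to r. *)
theory Submission
  imports Defs
begin

section \<open>Regularity of curves and of deformation fields\<close>

lemma differentiable_slice_fst:
  fixes f :: "real \<times> real \<Rightarrow> 'a::real_normed_vector"
  assumes "f differentiable (at (s, t))"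
  shows "((\<lambda>s. f (s, t)) has_vector_derivative frechet_derivative f (at (s, t)) (1, 0)) (at s)"
proof -
  have "((\<lambda>s::real. (s, t)) has_vector_derivative (1, 0)) (at s)"
    by (auto intro!: derivative_eq_intros simp: has_vector_derivative_def)
  moreover have "(f has_derivative frechet_derivative f (at (s, t))) (at (s, t))"
    using assms frechet_derivative_works by blast
  ultimately show ?thesis
    by (auto dest!: vector_derivative_diff_chain_within[where S=UNIV and g=f]
        intro: has_derivative_at_withinI simp: o_def)
qed

lemma differentiable_slice_snd:
  fixes f :: "real \<times> real \<Rightarrow> 'a::real_normed_vector"
  assumes "f differentiable (at (s, t))"
  shows "((\<lambda>t. f (s, t)) has_vector_derivative frechet_derivative f (at (s, t)) (0, 1)) (at t)"
proof -
  have "((\<lambda>t::real. (s, t)) has_vector_derivative (0, 1)) (at t)"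
    by (auto intro!: derivative_eq_intros simp: has_vector_derivative_def)
  moreover have "(f has_derivative frechet_derivative f (at (s, t))) (at (s, t))"
    using assms frechet_derivative_works by blast
  ultimately show ?thesis
    by (auto dest!: vector_derivative_diff_chain_within[where S=UNIV and g=f]
        intro: has_derivative_at_withinI simp: o_def)
qed

lemma closed_curve_has_vector_derivative:
  assumes "closed_curve T \<Gamma>"
  shows "(\<Gamma> has_vector_derivative vector_derivative \<Gamma> (at t)) (at t)"
proof -
  have "times_differentiable_on 1 UNIV \<Gamma>"
    using assms unfolding closed_curve_def smooth_on_def by blast
  then show ?thesis
    by (simp add: vector_derivative_works[symmetric])
qed

lemma closed_curve_continuous_vector_derivative:
  assumes "closed_curve T \<Gamma>"
  shows "continuous_on UNIV (\<lambda>t. vector_derivative \<Gamma> (at t))"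
proof -
  have 1: "times_differentiable_on 1 UNIV \<Gamma>"
    using assms unfolding closed_curve_def smooth_on_def by blast
  have "vector_derivative \<Gamma> (at t) = frechet_derivative \<Gamma> (at t) 1" for t
  proof -
    have "(\<Gamma> has_derivative (\<lambda>x. x *\<^sub>R vector_derivative \<Gamma> (at t))) (at t)"
      using closed_curve_has_vector_derivative[OF assms] by (simp add: has_vector_derivative_def)
    then show ?thesis
      by (metis frechet_derivative_at scaleR_one)
  qed
  with 1 show ?thesis by simp
qed

text \<open>A deformation field is given only pointwise in \<open>t\<close>, as a derivative in
  \<open>s\<close>, so its own derivative in \<open>t\<close> has to be produced. Differentiating
  \<open>G s u - G s a\<close> in \<open>s\<close> under the integral of its
  \<open>t\<close>-derivative shows \<open>U\<close> to be a primitive of the mixed derivative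
  \<open>w (0, t)\<close>. The third claim is then the exchange of the two differentiations.\<close>

lemma family_velocity:
  fixes G :: "real \<Rightarrow> real \<Rightarrow> 'a::euclidean_space"
  assumes smooth: "smooth_on ({-e<..<e} \<times> UNIV) (\<lambda>(s, t). G s t)" and e: "e > 0"
    and U: "\<And>t. ((\<lambda>s. G s t) has_vector_derivative U t) (at 0)"
  shows "(U has_vector_derivative vector_derivative U (at t)) (at t)"
    and "continuous_on UNIV (\<lambda>t. vector_derivative U (at t))"
    and "((\<lambda>s. vector_derivative (G s) (at t)) has_vector_derivative vector_derivative U (at t)) (at 0)"
proof -
  define f where "f = (\<lambda>(s, t). G s t)"
  \<comment> \<open>On the strip, \<open>h\<close> is the derivative of \<open>G\<close> in
    \<open>t\<close>, and \<open>w\<close> is the derivative of \<open>h\<close> in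
    \<open>s\<close>.\<close>
  define h where "h = (\<lambda>x. frechet_derivative f (at x) (0, 1))"
  define w where "w = (\<lambda>x. frechet_derivative h (at x) (1, 0))"
  let ?I = "{-e<..<e}"
  have "times_differentiable_on (Suc (Suc 0)) (?I \<times> UNIV) f"
    using smooth unfolding smooth_on_def f_def by blast
  then have fd: "f differentiable (at (s, t))" and hd: "h differentiable (at (s, t))"
    and wc: "continuous_on (?I \<times> UNIV) w" if "s \<in> ?I" for s t
    using that by (auto simp: h_def w_def)
  have zero: "0 \<in> ?I" using e by simp
  have Gt: "(G s has_vector_derivative h (s, t)) (at t)" if "s \<in> ?I" for s t
    using differentiable_slice_snd[OF fd[OF that]] by (simp add: f_def h_def)
  have hs: "((\<lambda>s. h (s, t)) has_vector_derivative w (s, t)) (at s)" if "s \<in> ?I" for s t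
    using differentiable_slice_fst[OF hd[OF that]] by (simp add: w_def)
  have hc: "continuous_on A (\<lambda>t. h (s, t))" if "s \<in> ?I" for s A
    by (intro continuous_at_imp_continuous_on ballI has_vector_derivative_continuous)
       (rule differentiable_slice_snd[OF hd[OF that]])
  have wc0: "continuous_on A (\<lambda>t. w (0, t))" for A
    by (rule continuous_on_compose2[OF wc[OF zero]]) (use zero in \<open>auto intro!: continuous_intros\<close>)
  have Uint: "U u = U a + integral {a..u} (\<lambda>t. w (0, t))" if "a \<le> u" for a u
  proof -
    have "((\<lambda>s. integral (cbox a u) (\<lambda>t. h (s, t))) has_vector_derivative
            integral (cbox a u) (\<lambda>t. w (0, t))) (at 0 within ?I)"
    \<comment> \<open>Differentiation under the integral needs \<open>w\<close> to be jointly
      continuous in \<open>s\<close> and \<open>t\<close>; second-order smoothness of the family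
      provides this.\<close>
    proof (rule leibniz_rule_vector_derivative)
      show "continuous_on (?I \<times> cbox a u) (\<lambda>(s, t). w (s, t))"
        by (simp, rule continuous_on_subset[OF wc[OF zero]]) auto
    qed (use zero hs hc in \<open>auto intro: has_vector_derivative_at_within integrable_continuous_real\<close>)
    then have "((\<lambda>s. integral {a..u} (\<lambda>t. h (s, t))) has_vector_derivative
            integral {a..u} (\<lambda>t. w (0, t))) (at 0)"
      using zero by (simp add: has_vector_derivative_def at_within_open[of 0 ?I])
    \<comment> \<open>The same integral equals \<open>G s u - G s a\<close>, so its derivative at 0
      can also be read off from \<open>U\<close>.\<close>
    moreover have "((\<lambda>s. integral {a..u} (\<lambda>t. h (s, t))) has_vector_derivative U u - U a) (at 0)"
    proof (rule has_vector_derivative_transform_within_open[where S="?I"])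
      show "((\<lambda>s. G s u - G s a) has_vector_derivative U u - U a) (at 0)"
        by (intro has_vector_derivative_diff U)
      fix s assume "s \<in> ?I"
      then have "((\<lambda>t. h (s, t)) has_integral G s u - G s a) {a..u}"
        by (intro fundamental_theorem_of_calculus[OF that] has_vector_derivative_at_within[OF Gt])
      then show "G s u - G s a = integral {a..u} (\<lambda>t. h (s, t))"
        by (simp add: integral_unique)
    qed (use zero in auto)
    ultimately have "integral {a..u} (\<lambda>t. w (0, t)) = U u - U a"
      by (rule vector_derivative_unique_at)
    then show ?thesis by simp
  qed
  have Ud: "(U has_vector_derivative w (0, t)) (at t)" for t
  proof -
    \<comment> \<open>The base point \<open>t - 1\<close> makes \<open>t\<close> interior to the
      interval, so the derivative within it is the two-sided one.\<close>
    have "((\<lambda>u. U (t - 1) + integral {t-1..u} (\<lambda>t. w (0, t))) has_vector_derivative 0 + w (0, t))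
            (at t within {t-1..t+1})"
      by (intro has_vector_derivative_add has_vector_derivative_const
          integral_has_vector_derivative wc0) auto
    then have "((\<lambda>u. U (t - 1) + integral {t-1..u} (\<lambda>t. w (0, t))) has_vector_derivative w (0, t)) (at t)"
      by (simp add: has_vector_derivative_def at_within_Icc_at)
    then show ?thesis
    proof (rule has_vector_derivative_transform_within_open)
      show "U (t - 1) + integral {t-1..u} (\<lambda>t. w (0, t)) = U u" if "u \<in> {t-1<..}" for u
        using Uint[of "t - 1" u] that by simp
    qed auto
  qed
  then have Uw: "vector_derivative U (at t) = w (0, t)" for t
    by (rule vector_derivative_at)
  show "(U has_vector_derivative vector_derivative U (at t)) (at t)"
    using Ud Uw by simp
  show "continuous_on UNIV (\<lambda>t. vector_derivative U (at t))"
    using wc0 Uw by simp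
  show "((\<lambda>s. vector_derivative (G s) (at t)) has_vector_derivative vector_derivative U (at t)) (at 0)"
    unfolding Uw
  proof (rule has_vector_derivative_transform_within_open[where S="?I"])
    show "((\<lambda>s. h (s, t)) has_vector_derivative w (0, t)) (at 0)"
      using hs zero by simp
    show "h (s, t) = vector_derivative (G s) (at t)" if "s \<in> ?I" for s
      by (rule vector_derivative_at[OF Gt[OF that], symmetric])
  qed (use zero in auto)
qed

section \<open>The bicycle relation and its linearisation\<close>

lemma bicycle_correspondence_velocities:
  assumes "bicycle_correspondence T d \<Gamma>1 \<Gamma>2"
  shows "\<exists>c. vector_derivative \<Gamma>1 (at t) + vector_derivative \<Gamma>2 (at t) = c *\<^sub>R (\<Gamma>1 t - \<Gamma>2 t)"
proof -
  obtain c where c: "vector_derivative (\<lambda>t. midpoint (\<Gamma>1 t) (\<Gamma>2 t)) (at t) = c *\<^sub>R (\<Gamma>1 t - \<Gamma>2 t)"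
    and cc: "closed_curve T \<Gamma>1" "closed_curve T \<Gamma>2"
    using assms unfolding bicycle_correspondence_def by blast
  have "((\<lambda>t. midpoint (\<Gamma>1 t) (\<Gamma>2 t)) has_vector_derivative
          (1/2) *\<^sub>R (vector_derivative \<Gamma>1 (at t) + vector_derivative \<Gamma>2 (at t))) (at t)"
    unfolding midpoint_def
    by (auto intro!: derivative_eq_intros cc[THEN closed_curve_has_vector_derivative])
  with c have "(1/2) *\<^sub>R (vector_derivative \<Gamma>1 (at t) + vector_derivative \<Gamma>2 (at t)) = c *\<^sub>R (\<Gamma>1 t - \<Gamma>2 t)"
    using vector_derivative_at by metis
  then have "2 *\<^sub>R ((1/2) *\<^sub>R (vector_derivative \<Gamma>1 (at t) + vector_derivative \<Gamma>2 (at t)))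
      = 2 *\<^sub>R (c *\<^sub>R (\<Gamma>1 t - \<Gamma>2 t))" by (rule arg_cong)
  then show ?thesis
    \<comment> \<open>The midpoint moves with half the sum of the two velocities, hence the factor
      2.\<close>
    by (intro exI[of _ "2 * c"]) simp
qed

lemma bicycle_correspondence_inner_diff:
  assumes "bicycle_correspondence T d \<Gamma>1 \<Gamma>2"
  shows "(\<Gamma>1 t - \<Gamma>2 t) \<bullet> (\<Gamma>1 t - \<Gamma>2 t) = d\<^sup>2"
  using assms unfolding bicycle_correspondence_def by (metis dist_norm power2_norm_eq_inner)

text \<open>Differentiate \<open>r y \<bullet> r y\<close>. This serves in two directions: in the
  deformation parameter, where the length is known only on an open interval, and in the time along
  the undeformed curves.\<close>

lemma constant_length_derivative_orthogonal:
  fixes r :: "real \<Rightarrow> 'a::real_inner"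
  assumes "(r has_vector_derivative r') (at x)" "open S" "x \<in> S" "\<And>y. y \<in> S \<Longrightarrow> r y \<bullet> r y = c"
  shows "r x \<bullet> r' = 0"
proof -
  have "((\<lambda>y. r y \<bullet> r y) has_vector_derivative (r x \<bullet> r' + r' \<bullet> r x)) (at x)"
    using assms(1) by (intro bounded_bilinear.has_vector_derivative[OF bounded_bilinear_inner])
  moreover have "((\<lambda>y. r y \<bullet> r y) has_vector_derivative 0) (at x)"
    by (rule has_vector_derivative_transform_within_open[where f="\<lambda>_. c" and S=S]) (use assms in auto)
  ultimately have "r x \<bullet> r' + r' \<bullet> r x = 0"
    by (rule vector_derivative_unique_at)
  then show ?thesis by (simp add: inner_commute)
qed

text \<open>The last claim differentiates the proportionality of \<open>m\<close> and
  \<open>r\<close> in the deformation parameter. The multiplier \<mu> enters as a premise because it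
  belongs to the undeformed pair: two deformations of one pair share it, while \<open>k\<close>
  varies with the deformation.\<close>

lemma infinitesimal_deformation_linearised:
  fixes \<Gamma>1 \<Gamma>2 U1 U2 :: "real \<Rightarrow> 'a::euclidean_space"
  assumes def: "infinitesimal_deformation T d \<Gamma>1 \<Gamma>2 U1 U2" and d: "d > 0"
  shows "(U1 has_vector_derivative vector_derivative U1 (at t)) (at t)"
    and "(U2 has_vector_derivative vector_derivative U2 (at t)) (at t)"
    and "continuous_on UNIV (\<lambda>t. vector_derivative U1 (at t))"
    and "continuous_on UNIV (\<lambda>t. vector_derivative U2 (at t))"
    and "U1 (t + T) = U1 t" and "U2 (t + T) = U2 t"
    and "(\<Gamma>1 t - \<Gamma>2 t) \<bullet> (U1 t - U2 t) = 0"
    and "vector_derivative \<Gamma>1 (at t) + vector_derivative \<Gamma>2 (at t) = \<mu> *\<^sub>R (\<Gamma>1 t - \<Gamma>2 t) \<Longrightarrow>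
      \<exists>k. vector_derivative U1 (at t) + vector_derivative U2 (at t)
        = k *\<^sub>R (\<Gamma>1 t - \<Gamma>2 t) + \<mu> *\<^sub>R (U1 t - U2 t)"
proof -
  obtain e G1 G2 where e: "e > 0"
    and sm: "smooth_on ({-e<..<e} \<times> UNIV) (\<lambda>(s, t). G1 s t)"
      "smooth_on ({-e<..<e} \<times> UNIV) (\<lambda>(s, t). G2 s t)"
    and bc: "\<And>s. s \<in> {-e<..<e} \<Longrightarrow> bicycle_correspondence T d (G1 s) (G2 s)"
    and G0: "G1 0 = \<Gamma>1" "G2 0 = \<Gamma>2"
    and U: "\<And>t. ((\<lambda>s. G1 s t) has_vector_derivative U1 t) (at 0)"
      "\<And>t. ((\<lambda>s. G2 s t) has_vector_derivative U2 t) (at 0)"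
    using def unfolding infinitesimal_deformation_def by blast
  note v1 = family_velocity[OF sm(1) e U(1)] and v2 = family_velocity[OF sm(2) e U(2)]
  show "(U1 has_vector_derivative vector_derivative U1 (at t)) (at t)"
    "(U2 has_vector_derivative vector_derivative U2 (at t)) (at t)"
    "continuous_on UNIV (\<lambda>t. vector_derivative U1 (at t))"
    "continuous_on UNIV (\<lambda>t. vector_derivative U2 (at t))"
    by (rule v1 v2)+
  let ?I = "{-e<..<e}"
  have zero: "0 \<in> ?I" using e by simp
  have per: "G1 s (t + T) = G1 s t" "G2 s (t + T) = G2 s t" if "s \<in> ?I" for s
    using bc[OF that] unfolding bicycle_correspondence_def closed_curve_def by auto
  show "U1 (t + T) = U1 t"
    \<comment> \<open>Both values are derivatives at 0 of functions of \<open>s\<close> that agree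
      on \<open>?I\<close>, every curve of the family having period \<open>T\<close>.\<close>
    by (rule vector_derivative_unique_at[OF _ U(1)],
        rule has_vector_derivative_transform_within_open[OF U(1), where S="?I"])
      (use per zero in auto)
  show "U2 (t + T) = U2 t"
    by (rule vector_derivative_unique_at[OF _ U(2)],
        rule has_vector_derivative_transform_within_open[OF U(2), where S="?I"])
      (use per zero in auto)
  define r where "r s = G1 s t - G2 s t" for s
  define m where "m s = vector_derivative (G1 s) (at t) + vector_derivative (G2 s) (at t)" for s
  have r0: "r 0 = \<Gamma>1 t - \<Gamma>2 t" and m0: "m 0 = vector_derivative \<Gamma>1 (at t) + vector_derivative \<Gamma>2 (at t)"
    by (simp_all add: r_def m_def G0)
  have rr: "r s \<bullet> r s = d\<^sup>2" if "s \<in> ?I" for s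
    using bicycle_correspondence_inner_diff[OF bc[OF that]] by (simp add: r_def)
  have dr: "(r has_vector_derivative U1 t - U2 t) (at 0)"
    unfolding r_def by (intro has_vector_derivative_diff U)
  have dm: "(m has_vector_derivative vector_derivative U1 (at t) + vector_derivative U2 (at t)) (at 0)"
    unfolding m_def by (intro has_vector_derivative_add v1 v2)
  show "(\<Gamma>1 t - \<Gamma>2 t) \<bullet> (U1 t - U2 t) = 0"
    using constant_length_derivative_orthogonal[OF dr open_greaterThanLessThan zero rr] r0 by simp
  assume mu: "vector_derivative \<Gamma>1 (at t) + vector_derivative \<Gamma>2 (at t) = \<mu> *\<^sub>R (\<Gamma>1 t - \<Gamma>2 t)"
  (* The factor of proportionality is expressed through m and r, so that it is differentiable in s. *)
  have mr: "(m s \<bullet> r s / d\<^sup>2) *\<^sub>R r s = m s" if sI: "s \<in> ?I" for s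
  proof -
    obtain c where "m s = c *\<^sub>R r s"
      using bicycle_correspondence_velocities[OF bc[OF sI], of t] by (auto simp: m_def r_def)
    then show ?thesis using rr[OF sI] d by simp
  qed
  \<comment> \<open>This is the derivative at 0 of the factor
    \<open>m s \<bullet> r s / d\<^sup>2\<close>, by the product rule.\<close>
  define k where "k = (m 0 \<bullet> (U1 t - U2 t)
    + (vector_derivative U1 (at t) + vector_derivative U2 (at t)) \<bullet> r 0) / d\<^sup>2"
  have "((\<lambda>s. m s \<bullet> r s) has_vector_derivative k * d\<^sup>2) (at 0)"
    using bounded_bilinear.has_vector_derivative[OF bounded_bilinear_inner dm dr] d
    by (simp add: k_def)
  then have "((\<lambda>s. m s \<bullet> r s / d\<^sup>2) has_vector_derivative k) (at 0)"
    using d unfolding has_real_derivative_iff_has_vector_derivative[symmetric]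
    by (auto dest: DERIV_cdivide[where c="d\<^sup>2"])
  then have "((\<lambda>s. (m s \<bullet> r s / d\<^sup>2) *\<^sub>R r s) has_vector_derivative
      (m 0 \<bullet> r 0 / d\<^sup>2) *\<^sub>R (U1 t - U2 t) + k *\<^sub>R r 0) (at 0)"
    using bounded_bilinear.has_vector_derivative[OF bounded_bilinear_scaleR _ dr] by blast
  then have "(m has_vector_derivative (m 0 \<bullet> r 0 / d\<^sup>2) *\<^sub>R (U1 t - U2 t) + k *\<^sub>R r 0) (at 0)"
    by (rule has_vector_derivative_transform_within_open[where S="?I"]) (use zero mr in auto)
  with dm have "vector_derivative U1 (at t) + vector_derivative U2 (at t)
      = (m 0 \<bullet> r 0 / d\<^sup>2) *\<^sub>R (U1 t - U2 t) + k *\<^sub>R r 0"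
    by (rule vector_derivative_unique_at)
  \<comment> \<open>At 0 the factor is the given multiplier, since \<open>r 0\<close> has squared
    length \<open>d\<^sup>2\<close>.\<close>
  moreover have "m 0 \<bullet> r 0 / d\<^sup>2 = \<mu>"
    using mu rr[OF zero] d by (simp add: m0 r0)
  ultimately show "\<exists>k. vector_derivative U1 (at t) + vector_derivative U2 (at t)
        = k *\<^sub>R (\<Gamma>1 t - \<Gamma>2 t) + \<mu> *\<^sub>R (U1 t - U2 t)"
    by (auto simp: r0 add.commute)
qed

section \<open>Exact differences of integrands, and the form omega\<close>

lemma integral_eq_if_diff_exact:
  fixes f g h :: "real \<Rightarrow> real"
  assumes "T \<ge> 0" "continuous_on {0..T} f" "continuous_on {0..T} g"
    and "\<And>t. (h has_vector_derivative f t - g t) (at t)" "h T = h 0"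
  shows "integral {0..T} f = integral {0..T} g"
proof -
  have "((\<lambda>t. f t - g t) has_integral h T - h 0) {0..T}"
    by (rule fundamental_theorem_of_calculus[OF assms(1)]) (rule has_vector_derivative_at_within[OF assms(4)])
  then have "integral {0..T} (\<lambda>t. f t - g t) = 0"
    using assms(5) by (simp add: integral_unique)
  then show ?thesis
    using integral_diff[OF assms(2,3)[THEN integrable_continuous_real]] by simp
qed

lemma omega_form_preserved:
  fixes d T :: real
  assumes "d > 0" and "T > 0"
  shows "bicycle_preserves T d
    (omega_form T :: (real \<Rightarrow> 'a::euclidean_space) \<Rightarrow> (real \<Rightarrow> 'a) \<Rightarrow> (real \<Rightarrow> 'a) \<Rightarrow> real)"
  unfolding bicycle_preserves_def omega_form_def
proof (intro allI impI)
  fix \<Gamma>1 \<Gamma>2 U1 U2 V1 V2 :: "real \<Rightarrow> 'a"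
  assume bc: "bicycle_correspondence T d \<Gamma>1 \<Gamma>2"
    and dU: "infinitesimal_deformation T d \<Gamma>1 \<Gamma>2 U1 U2"
    and dV: "infinitesimal_deformation T d \<Gamma>1 \<Gamma>2 V1 V2"
  note u = infinitesimal_deformation_linearised[OF dU assms(1)]
  note v = infinitesimal_deformation_linearised[OF dV assms(1)]
  have V: "continuous_on A V1" "continuous_on A V2" for A
    by (auto intro!: continuous_at_imp_continuous_on has_vector_derivative_continuous v)
  show "integral {0..T} (\<lambda>t. vector_derivative U1 (at t) \<bullet> V1 t)
      = integral {0..T} (\<lambda>t. vector_derivative U2 (at t) \<bullet> V2 t)"
  proof (rule integral_eq_if_diff_exact[where h="\<lambda>t. (U1 t - U2 t) \<bullet> (V1 t + V2 t) / 2"])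
    fix t
    obtain \<mu> where mu: "vector_derivative \<Gamma>1 (at t) + vector_derivative \<Gamma>2 (at t) = \<mu> *\<^sub>R (\<Gamma>1 t - \<Gamma>2 t)"
      using bicycle_correspondence_velocities[OF bc] by blast
    obtain k where k: "vector_derivative U1 (at t) + vector_derivative U2 (at t)
        = k *\<^sub>R (\<Gamma>1 t - \<Gamma>2 t) + \<mu> *\<^sub>R (U1 t - U2 t)" using u(8)[OF mu] by blast
    obtain j where j: "vector_derivative V1 (at t) + vector_derivative V2 (at t)
        = j *\<^sub>R (\<Gamma>1 t - \<Gamma>2 t) + \<mu> *\<^sub>R (V1 t - V2 t)" using v(8)[OF mu] by blast
    have "((\<lambda>t. (U1 t - U2 t) \<bullet> (V1 t + V2 t)) has_vector_derivative
        ((U1 t - U2 t) \<bullet> (vector_derivative V1 (at t) + vector_derivative V2 (at t))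
        + (vector_derivative U1 (at t) - vector_derivative U2 (at t)) \<bullet> (V1 t + V2 t))) (at t)"
      by (intro bounded_bilinear.has_vector_derivative[OF bounded_bilinear_inner]
          has_vector_derivative_add has_vector_derivative_diff u v)
    \<comment> \<open>Both sides equal \<mu> times the inner product of \<open>U1 t - U2 t\<close>
      and \<open>V1 t - V2 t\<close>: the terms with \<open>j\<close> and \<open>k\<close> vanish by
      orthogonality to \<open>\<Gamma>1 t - \<Gamma>2 t\<close>. After this exchange the mixed
      products in the derivative cancel.\<close>
    moreover have "(U1 t - U2 t) \<bullet> (vector_derivative V1 (at t) + vector_derivative V2 (at t))
        = (vector_derivative U1 (at t) + vector_derivative U2 (at t)) \<bullet> (V1 t - V2 t)"
      unfolding k j using u(7)[of t] v(7)[of t] by (simp add: inner_add_left inner_add_right inner_commute)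
    then have "(U1 t - U2 t) \<bullet> (vector_derivative V1 (at t) + vector_derivative V2 (at t))
        + (vector_derivative U1 (at t) - vector_derivative U2 (at t)) \<bullet> (V1 t + V2 t)
      = 2 * (vector_derivative U1 (at t) \<bullet> V1 t - vector_derivative U2 (at t) \<bullet> V2 t)"
      by (simp add: inner_simps)
    ultimately show "((\<lambda>t. (U1 t - U2 t) \<bullet> (V1 t + V2 t) / 2) has_vector_derivative
        vector_derivative U1 (at t) \<bullet> V1 t - vector_derivative U2 (at t) \<bullet> V2 t) (at t)"
      by (auto intro!: derivative_eq_intros simp: has_real_derivative_iff_has_vector_derivative[symmetric])
  \<comment> \<open>Periodicity at 0 makes the primitive agree at 0 and \<open>T\<close>; the rest
    is continuity of the integrands.\<close>
  qed (use assms u(5,6)[of 0] v(5,6)[of 0] in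
      \<open>auto intro!: continuous_intros V continuous_on_subset[OF u(3)] continuous_on_subset[OF u(4)]\<close>)
qed

section \<open>The form Omega in dimension three\<close>

lemma cross3_derivative:
  assumes "(f has_vector_derivative f') (at t)" "(g has_vector_derivative g') (at t)"
  shows "((\<lambda>t. cross3 (f t) (g t)) has_vector_derivative cross3 (f t) g' + cross3 f' (g t)) (at t)"
  using assms bilinear_cross bilinear_conv_bounded_bilinear
  by (intro bounded_bilinear.has_vector_derivative) blast+

text \<open>The three vectors lie in the plane orthogonal to \<open>r\<close>; equivalently, the
  matrix with these rows has \<open>r\<close> in its kernel and so is singular.\<close>

lemma triple_product_eq_0:
  fixes a b c r :: "real^3"
  assumes "r \<noteq> 0" "r \<bullet> a = 0" "r \<bullet> b = 0" "r \<bullet> c = 0"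
  shows "a \<bullet> cross3 b c = 0"
proof -
  have "(vector [a, b, c] :: real^3^3) *v r = 0"
    using assms by (simp add: vec_eq_iff forall_3 matrix_vector_mul_component inner_commute)
  with \<open>r \<noteq> 0\<close> have "\<not> invertible (vector [a, b, c] :: real^3^3)"
    using matrix_left_invertible_ker invertible_def by blast
  then show ?thesis
    by (simp add: dot_cross_det invertible_det_nz)
qed

lemma Omega_form_preserved:
  fixes d T :: real
  assumes "d > 0" and "T > 0"
  shows "bicycle_preserves T d (Omega_form T)"
  \<comment> \<open>Triple products replace determinants, so that the product rules for the inner
    and the cross product apply.\<close>
  unfolding bicycle_preserves_def Omega_form_def dot_cross_det[symmetric]
proof (intro allI impI)
  fix \<Gamma>1 \<Gamma>2 U1 U2 V1 V2 :: "real \<Rightarrow> real^3"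
  assume bc: "bicycle_correspondence T d \<Gamma>1 \<Gamma>2"
    and dU: "infinitesimal_deformation T d \<Gamma>1 \<Gamma>2 U1 U2"
    and dV: "infinitesimal_deformation T d \<Gamma>1 \<Gamma>2 V1 V2"
  note u = infinitesimal_deformation_linearised[OF dU assms(1)]
  note v = infinitesimal_deformation_linearised[OF dV assms(1)]
  have cc: "closed_curve T \<Gamma>1" "closed_curve T \<Gamma>2"
    using bc unfolding bicycle_correspondence_def by auto
  note g = cc[THEN closed_curve_has_vector_derivative]
  note gc = cc[THEN closed_curve_continuous_vector_derivative, THEN continuous_on_subset]
  have per: "\<Gamma>1 T = \<Gamma>1 0" "\<Gamma>2 T = \<Gamma>2 0"
    using cc unfolding closed_curve_def by (metis add_0)+
  have UV: "continuous_on A U1" "continuous_on A U2" "continuous_on A V1" "continuous_on A V2" for A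
    by (auto intro!: continuous_at_imp_continuous_on has_vector_derivative_continuous u v)
  show "integral {0..T} (\<lambda>t. vector_derivative \<Gamma>1 (at t) \<bullet> cross3 (U1 t) (V1 t))
      = integral {0..T} (\<lambda>t. vector_derivative \<Gamma>2 (at t) \<bullet> cross3 (U2 t) (V2 t))"
  proof (rule integral_eq_if_diff_exact
      [where h="\<lambda>t. (\<Gamma>1 t - \<Gamma>2 t) \<bullet> cross3 (U1 t + U2 t) (V1 t + V2 t) / 4"])
    fix t
    define x1 x2 where "x1 = vector_derivative \<Gamma>1 (at t)" and "x2 = vector_derivative \<Gamma>2 (at t)"
    define r where "r = \<Gamma>1 t - \<Gamma>2 t"
    define p' P' where "p' = vector_derivative U1 (at t) + vector_derivative U2 (at t)"
      and "P' = vector_derivative V1 (at t) + vector_derivative V2 (at t)"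
    define p q P Q where "p = U1 t + U2 t" and "q = U1 t - U2 t" and "P = V1 t + V2 t" and "Q = V1 t - V2 t"
    obtain \<mu> where mu: "vector_derivative \<Gamma>1 (at t) + vector_derivative \<Gamma>2 (at t) = \<mu> *\<^sub>R (\<Gamma>1 t - \<Gamma>2 t)"
      using bicycle_correspondence_velocities[OF bc] by blast
    then have m: "x1 + x2 = \<mu> *\<^sub>R r" by (simp add: x1_def x2_def r_def)
    obtain k where k: "p' = k *\<^sub>R r + \<mu> *\<^sub>R q"
      using u(8)[OF mu] by (auto simp: p'_def r_def q_def)
    obtain j where j: "P' = j *\<^sub>R r + \<mu> *\<^sub>R Q"
      using v(8)[OF mu] by (auto simp: P'_def r_def Q_def)
    have rr: "r \<bullet> r = d\<^sup>2"
      using bicycle_correspondence_inner_diff[OF bc] by (simp add: r_def)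
    have orth: "(x1 - x2) \<bullet> cross3 q Q = 0"
    proof (rule triple_product_eq_0)
      show "r \<noteq> 0" using rr assms(1) by auto
      show "r \<bullet> q = 0" "r \<bullet> Q = 0" using u(7) v(7) by (auto simp: r_def q_def Q_def)
      show "r \<bullet> (x1 - x2) = 0"
        unfolding r_def x1_def x2_def
        by (rule constant_length_derivative_orthogonal[where S=UNIV and r="\<lambda>t. \<Gamma>1 t - \<Gamma>2 t" and c="d\<^sup>2"])
          (auto intro!: has_vector_derivative_diff g bicycle_correspondence_inner_diff[OF bc])
    qed
    have "((\<lambda>t. (\<Gamma>1 t - \<Gamma>2 t) \<bullet> cross3 (U1 t + U2 t) (V1 t + V2 t)) has_vector_derivative
        r \<bullet> (cross3 p P' + cross3 p' P) + (x1 - x2) \<bullet> cross3 p P) (at t)"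
      unfolding r_def x1_def x2_def p_def P_def p'_def P'_def
      by (intro bounded_bilinear.has_vector_derivative[OF bounded_bilinear_inner] cross3_derivative
          has_vector_derivative_add has_vector_derivative_diff u v g)
    \<comment> \<open>The multiples of \<open>r\<close> in \<open>p'\<close> and \<open>P'\<close>
      drop out of a triple product with \<open>r\<close>. The remaining factor \<mu> is moved onto
      \<open>r\<close>, where \<open>m\<close> turns it into \<open>x1 + x2\<close>.\<close>
    moreover have "r \<bullet> (cross3 p P' + cross3 p' P) = (x1 + x2) \<bullet> (cross3 p Q + cross3 q P)"
      unfolding m k j
      by (simp add: cross_add_left cross_add_right cross_mult_left cross_mult_right
          dot_cross_self algebra_simps)
    \<comment> \<open>Write each of the six vectors as half a sum or difference of
      \<open>x1 + x2\<close>, \<open>p\<close>, \<open>P\<close> and \<open>x1 - x2\<close>,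
      \<open>q\<close>, \<open>Q\<close>. Subtracting the two triple products leaves the terms with
      an odd number of differences, each with coefficient 1/4. The term with three differences is
      the one that \<open>orth\<close> removes.\<close>
    moreover have "(x1 + x2) \<bullet> (cross3 p Q + cross3 q P) + (x1 - x2) \<bullet> cross3 p P
        = 4 * (x1 \<bullet> cross3 (U1 t) (V1 t) - x2 \<bullet> cross3 (U2 t) (V2 t)) - (x1 - x2) \<bullet> cross3 q Q"
      unfolding p_def q_def P_def Q_def
      unfolding cross_add_left cross_add_right Cross3.left_diff_distrib Cross3.right_diff_distrib
        inner_simps
      by algebra
    ultimately have "((\<lambda>t. (\<Gamma>1 t - \<Gamma>2 t) \<bullet> cross3 (U1 t + U2 t) (V1 t + V2 t)) has_vector_derivative
        4 * (x1 \<bullet> cross3 (U1 t) (V1 t) - x2 \<bullet> cross3 (U2 t) (V2 t))) (at t)"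
      using orth by simp
    then show "((\<lambda>t. (\<Gamma>1 t - \<Gamma>2 t) \<bullet> cross3 (U1 t + U2 t) (V1 t + V2 t) / 4) has_vector_derivative
        vector_derivative \<Gamma>1 (at t) \<bullet> cross3 (U1 t) (V1 t)
        - vector_derivative \<Gamma>2 (at t) \<bullet> cross3 (U2 t) (V2 t)) (at t)"
      unfolding x1_def x2_def
      by (auto intro!: derivative_eq_intros simp: has_real_derivative_iff_has_vector_derivative[symmetric])
  \<comment> \<open>Here the primitive also contains the base curves, so their periodicity
    \<open>per\<close> is needed besides that of the fields.\<close>
  qed (use assms per u(5,6)[of 0] v(5,6)[of 0] in
      \<open>auto intro!: continuous_intros continuous_on_cross UV gc\<close>)
qed

theorem theorem4:
  fixes l T :: real
  assumes "l > 0" and "T > 0"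
  shows "bicycle_preserves T (2 * l)
           (omega_form T :: (real \<Rightarrow> real^'n) \<Rightarrow> (real \<Rightarrow> real^'n) \<Rightarrow> (real \<Rightarrow> real^'n) \<Rightarrow> real)
       \<and> bicycle_preserves T (2 * l) (Omega_form T)"
  using assms by (intro conjI omega_form_preserved Omega_form_preserved) auto

end
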